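(* Let $\Omega$ be a locally compact groupoid on $B$ for which the target projection $\beta$ is an open map and whose base subgroupoid $\tilde B$ is paracompact. Assume that for any morphism $F:\Omega\to\mathbf{R}$ the continuity of $F$ at all $\tilde u\in\tilde B$ implies the continuity of $F$ everywhere on $\Omega$. Then for each $v\in B$ with non-singleton orbit (that is, $[v]\neq\{v\}$), the map $\beta_v:\Omega_v\to B$, $\beta_v(x)=\beta(x)$, is open.
   Context: A groupoid $\Omega$ on a base $B$ has source projection $\alpha:\Omega\to B$, target projection $\beta:\Omega\to B$, object inclusion map $u\mapsto\tilde u$ from $B$ to $\Omega$, and a partial multiplication $xy$ defined exactly when $(x,y)\in\Omega*\Omega=\{(x,y)\in\Omega\times\Omega:\alpha(x)=\beta(y)\}$, with $\alpha(xy)=\alpha(y)$, $\beta(xy)=\beta(x)$, associativity, $\alpha(\tilde u)=\beta(\tilde u)=u$, $x\widetilde{\alpha(x)}=x$, $\widetilde{\beta(x)}x=x$, and two-sided inverses: $\alpha(x^{-1})=\beta(x)$, $\beta(x^{-1})=\alpha(x)$, $x^{-1}x=\widetilde{\alpha(x)}$, $xx^{-1}=\widetilde{\beta(x)}$. The base subgroupoid is $\tilde B=\{\tilde u:u\in B\}\subseteq\Omega$. For $u,v\in B$: $\Omega_v=\alpha^{-1}(\{v\})$ (with the subspace topology), $\Omega^u=\beta^{-1}(\{u\})$, $\Omega_v^u=\Omega^u\cap\Omega_v$. The relation $u\sim v$ iff $\Omega_v^u\neq\emptyset$ is an equivalence relation on $B$; its classes are the orbits, and $[v]$ denotes the orbit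 of $v$. A topological groupoid is a groupoid $\Omega$ on $B$ with topologies on $\Omega$ and $B$ such that $\alpha$, $\beta$, the object inclusion map, the inversion, and the partial multiplication (with $\Omega*\Omega$ carrying the subspace topology from $\Omega\times\Omega$) are continuous. A locally compact groupoid is a topological groupoid whose topology is locally compact Hausdorff. A morphism $F:\Omega\to\mathbf{R}$ is a (not necessarily continuous) function into the additive group of real numbers with $F(xy)=F(x)+F(y)$ for every composable pair $(x,y)\in\Omega*\Omega$. *)

theory Defs
  imports "HOL-Analysis.Analysis"
begin

text \<open>The carrier \<open>G\<close> and the base \<open>B\<close> are sets, so all maps are only constrained
  there; in particular the product \<open>x \<cdot> y\<close> is meaningful only when
  \<open>x, y \<in> G\<close> and \<open>\<alpha> x = \<beta> y\<close>. The map \<open>\<iota>\<close> is the object inclusion.\<close>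

locale groupoid =
  fixes G :: "'a set" and B :: "'b set"
    and \<alpha> :: "'a \<Rightarrow> 'b" and \<beta> :: "'a \<Rightarrow> 'b"
    and \<iota> :: "'b \<Rightarrow> 'a"
    and gmult :: "'a \<Rightarrow> 'a \<Rightarrow> 'a"  (infixl "\<cdot>" 70)
    and ginv :: "'a \<Rightarrow> 'a"
  assumes source_in: "x \<in> G \<Longrightarrow> \<alpha> x \<in> B"
    and target_in: "x \<in> G \<Longrightarrow> \<beta> x \<in> B"
    and unit_in: "u \<in> B \<Longrightarrow> \<iota> u \<in> G"
    and mult_in: "\<lbrakk>x \<in> G; y \<in> G; \<alpha> x = \<beta> y\<rbrakk> \<Longrightarrow> x \<cdot> y \<in> G"
    and inv_in: "x \<in> G \<Longrightarrow> ginv x \<in> G"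
    and source_mult: "\<lbrakk>x \<in> G; y \<in> G; \<alpha> x = \<beta> y\<rbrakk> \<Longrightarrow> \<alpha> (x \<cdot> y) = \<alpha> y"
    and target_mult: "\<lbrakk>x \<in> G; y \<in> G; \<alpha> x = \<beta> y\<rbrakk> \<Longrightarrow> \<beta> (x \<cdot> y) = \<beta> x"
    and mult_assoc: "\<lbrakk>x \<in> G; y \<in> G; z \<in> G; \<alpha> x = \<beta> y; \<alpha> y = \<beta> z\<rbrakk>
          \<Longrightarrow> (x \<cdot> y) \<cdot> z = x \<cdot> (y \<cdot> z)"
    and source_unit: "u \<in> B \<Longrightarrow> \<alpha> (\<iota> u) = u"
    and target_unit: "u \<in> B \<Longrightarrow> \<beta> (\<iota> u) = u"
    and mult_unit_right: "x \<in> G \<Longrightarrow> x \<cdot> \<iota> (\<alpha> x) = x"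
    and mult_unit_left: "x \<in> G \<Longrightarrow> \<iota> (\<beta> x) \<cdot> x = x"
    and source_inv: "x \<in> G \<Longrightarrow> \<alpha> (ginv x) = \<beta> x"
    and target_inv: "x \<in> G \<Longrightarrow> \<beta> (ginv x) = \<alpha> x"
    and inv_left: "x \<in> G \<Longrightarrow> ginv x \<cdot> x = \<iota> (\<alpha> x)"
    and inv_right: "x \<in> G \<Longrightarrow> x \<cdot> ginv x = \<iota> (\<beta> x)"

definition composable :: "'a set \<Rightarrow> ('a \<Rightarrow> 'b) \<Rightarrow> ('a \<Rightarrow> 'b) \<Rightarrow> ('a \<times> 'a) set" where
  "composable G \<alpha> \<beta> = {(x, y). x \<in> G \<and> y \<in> G \<and> \<alpha> x = \<beta> y}"

definition source_fibre :: "'a set \<Rightarrow> ('a \<Rightarrow> 'b) \<Rightarrow> 'b \<Rightarrow> 'a set" where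
  "source_fibre G \<alpha> v = {x \<in> G. \<alpha> x = v}"

definition target_fibre :: "'a set \<Rightarrow> ('a \<Rightarrow> 'b) \<Rightarrow> 'b \<Rightarrow> 'a set" where
  "target_fibre G \<beta> u = {x \<in> G. \<beta> x = u}"

definition groupoid_orbit ::
    "'a set \<Rightarrow> 'b set \<Rightarrow> ('a \<Rightarrow> 'b) \<Rightarrow> ('a \<Rightarrow> 'b) \<Rightarrow> 'b \<Rightarrow> 'b set" where
  "groupoid_orbit G B \<alpha> \<beta> v = {u \<in> B. target_fibre G \<beta> u \<inter> source_fibre G \<alpha> v \<noteq> {}}"

definition real_morphism ::
    "'a set \<Rightarrow> ('a \<Rightarrow> 'b) \<Rightarrow> ('a \<Rightarrow> 'b) \<Rightarrow> ('a \<Rightarrow> 'a \<Rightarrow> 'a) \<Rightarrow> ('a \<Rightarrow> real) \<Rightarrow> bool" where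
  "real_morphism G \<alpha> \<beta> gmult F \<longleftrightarrow>
     (\<forall>(x, y) \<in> composable G \<alpha> \<beta>. F (gmult x y) = F x + F y)"

locale topological_groupoid =
  groupoid "topspace \<Omega>" "topspace B" \<alpha> \<beta> \<iota> gmult ginv
  for \<Omega> :: "'a topology" and B :: "'b topology"
    and \<alpha> :: "'a \<Rightarrow> 'b" and \<beta> :: "'a \<Rightarrow> 'b"
    and \<iota> :: "'b \<Rightarrow> 'a"
    and gmult :: "'a \<Rightarrow> 'a \<Rightarrow> 'a"
    and ginv :: "'a \<Rightarrow> 'a" +
  assumes continuous_source: "continuous_map \<Omega> B \<alpha>"
    and continuous_target: "continuous_map \<Omega> B \<beta>"
    and continuous_unit: "continuous_map B \<Omega> \<iota>"
    and continuous_inv: "continuous_map \<Omega> \<Omega> ginv"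
    and continuous_mult:
      "continuous_map (subtopology (prod_topology \<Omega> \<Omega>) (composable (topspace \<Omega>) \<alpha> \<beta>)) \<Omega>
         (\<lambda>(x, y). gmult x y)"

locale locally_compact_groupoid = topological_groupoid +
  assumes locally_compact: "locally_compact_space \<Omega>"
    and Hausdorff: "Hausdorff_space \<Omega>"

text \<open>No separation axiom is built in, since the definition is only applied to subspaces of
  Hausdorff spaces.\<close>

definition paracompact_space :: "'a topology \<Rightarrow> bool" where
  "paracompact_space X \<longleftrightarrow>
     (\<forall>\<U>. (\<forall>U\<in>\<U>. openin X U) \<and> \<Union>\<U> = topspace X \<longrightarrow>
        (\<exists>\<V>. (\<forall>V\<in>\<V>. openin X V) \<and> \<Union>\<V> = topspace X \<and>
             (\<forall>V\<in>\<V>. \<exists>U\<in>\<U>. V \<subseteq> U) \<and> locally_finite_in X \<V>))"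

end

theory Submission
  imports Defs
begin

text \<open>
  Openness of \<open>\<beta>\<close> on source fibres is a statement about units: right translation by \<open>x\<close> carries
  the fibre over \<open>\<beta> x\<close> to the fibre of \<open>x\<close>, takes the unit at \<open>\<beta> x\<close> to \<open>x\<close> and leaves \<open>\<beta>\<close>
  unchanged. So let \<open>w\<close> be a point of the orbit of \<open>v\<close> and \<open>U\<close> a neighbourhood of the unit at \<open>w\<close>;
  the set of targets of arrows in \<open>U\<close> with source \<open>w\<close> must be a neighbourhood of \<open>w\<close>.

  The neighbourhoods of the whole unit space, read as relations \<open>{(\<alpha> y, \<beta> y) | y \<in> V}\<close>, behave like
  the entourages of a uniformity on \<open>B\<close>; paracompactness of the unit space enters here, to find \<open>V\<close>
  with \<open>V \<cdot> V \<subseteq> W\<close> (\<open>unit_nhd_square\<close>). As for any uniformity, there is a uniformly continuous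
  \<open>f : B \<rightarrow> [0,1]\<close> that vanishes at \<open>w\<close> and is less than \<open>1\<close> only at targets of arrows in \<open>U\<close> with
  source \<open>w\<close> (\<open>uniformly_continuous_base_bump\<close>). Uniform continuity of \<open>f\<close> says precisely that the
  morphism \<open>y \<mapsto> f (\<beta> y) - f (\<alpha> y)\<close> is continuous at every unit, whereas \<open>f\<close> itself need not be
  continuous for the topology of \<open>B\<close>.

  The assumption on morphisms turns this into continuity of \<open>f\<close> at \<open>w\<close> itself. Since the orbit is
  not a singleton, some arrow \<open>k\<close> ends at \<open>w\<close> and starts elsewhere. Multiply \<open>f\<close> by a continuous
  function \<open>g\<close> with value \<open>1\<close> at \<open>w\<close> and \<open>0\<close> at the source of \<open>k\<close>, which exists because a locally
  compact Hausdorff space is completely regular. The morphism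
  \<open>F y = f (\<beta> y) * g (\<beta> y) - f (\<alpha> y) * g (\<alpha> y)\<close> is still continuous at units, hence everywhere.
  Near \<open>k\<close> its second term is small and \<open>F\<close> is close to \<open>F k = 0\<close>, so \<open>f (\<beta> y)\<close> is small; as \<open>\<beta>\<close> is
  open, \<open>f\<close> is less than \<open>1\<close> on a neighbourhood of \<open>w\<close> (\<open>target_nhd_at_unit\<close>).
\<close>

section \<open>Uniformly continuous functions from entourage filters\<close>

text \<open>The construction of Urysohn's lemma, with topological separation replaced by the relation
  \<open>R S T\<close> that some entourage maps \<open>S\<close> into \<open>T\<close>. That relation can be interpolated because entourages have
  square roots, which gives a scale of sets indexed by the dyadic numbers in \<open>[0,1]\<close>; \<open>f x\<close> is the
  infimum of the indices of the sets that contain \<open>x\<close>. The filter stands for a uniformity on a part of the type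
  \<open>'b\<close>, so \<open>E\<close> is only asked to contain the pair \<open>(w, w)\<close>.\<close>

lemma uniformly_continuous_bump:
  fixes F :: "('b \<times> 'b) filter"
  assumes sym: "\<And>E. eventually E F \<Longrightarrow> eventually (\<lambda>(x, y). E (y, x)) F"
    and trans: "\<And>E. eventually E F \<Longrightarrow>
          \<exists>D. eventually D F \<and> (\<forall>x y z. D (x, y) \<longrightarrow> D (y, z) \<longrightarrow> E (x, z))"
    and E: "eventually E F" "E (w, w)"
  obtains f :: "'b \<Rightarrow> real" where "\<And>x. 0 \<le> f x" "\<And>x. f x \<le> 1" "f w = 0"
    "\<And>x. f x < 1 \<Longrightarrow> E (w, x)"
    "\<And>\<epsilon>. \<epsilon> > 0 \<Longrightarrow> eventually (\<lambda>(x, y). \<bar>f x - f y\<bar> < \<epsilon>) F"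
proof -
  define R where "R S T \<longleftrightarrow> S \<subseteq> T \<and> eventually (\<lambda>(x, y). x \<in> S \<longrightarrow> y \<in> T) F" for S T :: "'b set"
  have base: "R {w} {x. E (w, x)}"
    using E by (auto simp: R_def elim!: eventually_mono)
  have step: "\<exists>Z. R S Z \<and> R Z T" if "R S T" for S T
  proof -
    from that have ST: "S \<subseteq> T" and ev: "eventually (\<lambda>(x, y). x \<in> S \<longrightarrow> y \<in> T) F"
      by (auto simp: R_def)
    obtain D where D: "eventually D F"
      and DD: "\<And>x y z. D (x, y) \<Longrightarrow> D (y, z) \<Longrightarrow> x \<in> S \<Longrightarrow> z \<in> T"
      using trans[OF ev] by fast
    define D' where "D' = (\<lambda>(x, y). D (x, y) \<and> (x \<in> S \<longrightarrow> y \<in> T))"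
    have D': "eventually D' F"
      using eventually_conj[OF D ev] by (rule eventually_mono) (auto simp: D'_def)
    define Z where "Z = S \<union> {z. \<exists>x\<in>S. D' (x, z)}"
    have "R S Z"
      unfolding R_def using D' by (auto simp: Z_def elim!: eventually_mono)
    moreover have "R Z T"
      unfolding R_def
    proof
      show "Z \<subseteq> T"
        using ST by (auto simp: Z_def D'_def)
      show "eventually (\<lambda>(x, y). x \<in> Z \<longrightarrow> y \<in> T) F"
        using D' by (rule eventually_mono) (auto simp: Z_def D'_def dest: DD)
    qed
    ultimately show ?thesis
      by blast
  qed
  have trans_R: "R S U" if "R S T" "R T U" for S T U
    using that unfolding R_def by (auto elim!: eventually_mono)
  obtain G :: "real \<Rightarrow> 'b set" where G0: "G 0 = {w}" and G1: "G 1 = {x. E (w, x)}"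
    and G: "\<And>r s. r \<in> dyadics \<inter> {0..1} \<Longrightarrow> s \<in> dyadics \<inter> {0..1} \<Longrightarrow> r < s \<Longrightarrow> R (G r) (G s)"
  proof -
    have "\<exists>G :: real \<Rightarrow> 'b set. G 0 = {w} \<and> G 1 = {x. E (w, x)} \<and>
        (\<forall>r\<in>dyadics \<inter> {0..1}. \<forall>s\<in>dyadics \<inter> {0..1}. r < s \<longrightarrow> R (G r) (G s))"
      by (rule recursion_on_dyadic_fractions; fact base step trans_R)
    then show ?thesis
      using that by blast
  qed
  define f where "f x = Inf (insert 1 {r. r \<in> dyadics \<inter> {0..1} \<and> x \<in> G r})" for x
  have bdd: "bdd_below (insert 1 {r. r \<in> dyadics \<inter> {0..1} \<and> x \<in> G r})" for x
    by (rule bdd_belowI[of _ 0]) auto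
  have f_ge: "0 \<le> f x" for x
    unfolding f_def by (rule cInf_greatest) auto
  have f_le1: "f x \<le> 1" for x
    unfolding f_def by (rule cInf_lower[OF _ bdd]) auto
  have f_le: "f x \<le> r" if "r \<in> dyadics \<inter> {0..1}" "x \<in> G r" for x r
    unfolding f_def by (rule cInf_lower[OF _ bdd]) (use that in auto)
  have f_less: "x \<in> G r" if r: "r \<in> dyadics \<inter> {0..1}" and less: "f x < r" for x r
  proof -
    have "\<exists>s\<in>insert 1 {s. s \<in> dyadics \<inter> {0..1} \<and> x \<in> G s}. s < r"
      using less unfolding f_def by (subst (asm) cInf_less_iff[OF _ bdd]) auto
    then obtain s where "s \<in> dyadics \<inter> {0..1}" "x \<in> G s" "s < r"
      using r by auto
    then show ?thesis
      using G[of s r] r by (auto simp: R_def)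
  qed
  have dy: "real i / 2 ^ N \<in> dyadics \<inter> {0..1}" if "i \<le> 2 ^ N" for i N
    using that by (auto simp: dyadics_def divide_le_eq)
  have 01: "0 \<in> dyadics \<inter> {0..1::real}" "1 \<in> dyadics \<inter> {0..1::real}"
    using dy[of 0 0] dy[of 1 0] by auto
  have "f w = 0"
    using f_le[OF 01(1)] f_ge[of w] G0 by force
  moreover have "E (w, x)" if "f x < 1" for x
    using f_less[OF 01(2) that] G1 by simp
  moreover have "eventually (\<lambda>(x, y). \<bar>f x - f y\<bar> < \<epsilon>) F" if "\<epsilon> > 0" for \<epsilon>
  proof -
    obtain N where "(1 / 2) ^ N < \<epsilon> / 2"
      using real_arch_pow_inv[of "\<epsilon> / 2" "1 / 2"] \<open>\<epsilon> > 0\<close> by auto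
    then have N: "2 / 2 ^ N < \<epsilon>"
      by (simp add: power_divide field_simps)
    \<comment> \<open>Finitely many grid points suffice, so a single entourage moves each set of the grid into
      the next one.\<close>
    define P where "P = (\<lambda>(x, y). \<forall>i\<in>{..<(2::nat) ^ N}.
      x \<in> G (real i / 2 ^ N) \<longrightarrow> y \<in> G (real (Suc i) / 2 ^ N))"
    have "eventually (\<lambda>z. \<forall>i\<in>{..<(2::nat) ^ N}.
      (\<lambda>(x, y). x \<in> G (real i / 2 ^ N) \<longrightarrow> y \<in> G (real (Suc i) / 2 ^ N)) z) F"
    proof (rule eventually_ball_finite, simp, intro ballI)
      fix i assume "i \<in> {..<(2::nat) ^ N}"
      then have "R (G (real i / 2 ^ N)) (G (real (Suc i) / 2 ^ N))"
        by (intro G dy) (auto simp: divide_strict_right_mono)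
      then show "\<forall>\<^sub>F z in F. case z of (x, y) \<Rightarrow>
          x \<in> G (real i / 2 ^ N) \<longrightarrow> y \<in> G (real (Suc i) / 2 ^ N)"
        by (simp add: R_def)
    qed
    then have P: "eventually P F"
      by (rule eventually_mono) (auto simp: P_def)
    \<comment> \<open>\<open>i / 2 ^ N\<close> is the first grid point above \<open>f x\<close>, so passing to \<open>y\<close> costs at most two
      grid steps.\<close>
    have close: "f y \<le> f x + 2 / 2 ^ N" if "P (x, y)" for x y
    proof -
      define i where "i = Suc (nat \<lfloor>f x * 2 ^ N\<rfloor>)"
      have nn: "0 \<le> f x * 2 ^ N"
        using f_ge by simp
      have i: "f x * 2 ^ N < real i" "real i \<le> f x * 2 ^ N + 1"
        unfolding i_def using nn by linarith+
      then have i': "f x < real i / 2 ^ N" "real i / 2 ^ N \<le> f x + 1 / 2 ^ N"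
        by (simp_all add: field_simps)
      show ?thesis
      proof (cases "i < 2 ^ N")
        case True
        then have "x \<in> G (real i / 2 ^ N)"
          using i' by (intro f_less dy) auto
        with that True have "y \<in> G (real (Suc i) / 2 ^ N)"
          by (auto simp: P_def)
        with True have "f y \<le> real (Suc i) / 2 ^ N"
          by (intro f_le dy) auto
        with i' show ?thesis
          by (simp add: add_divide_distrib)
      next
        case False
        then have "real i \<ge> 2 ^ N"
          by (metis linorder_not_less of_nat_le_iff of_nat_numeral of_nat_power)
        then have "1 \<le> real i / 2 ^ N"
          by simp
        moreover have "1 / (2::real) ^ N \<le> 2 / 2 ^ N"
          by (simp add: divide_right_mono)
        ultimately show ?thesis
          using i'(2) f_le1[of y] by linarith
      qed
    qed
    show ?thesis
      using eventually_conj[OF P sym[OF P]]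
    proof (rule eventually_mono)
      fix z assume z: "P z \<and> (case z of (x, y) \<Rightarrow> P (y, x))"
      obtain x y where xy: "z = (x, y)"
        by (cases z)
      then have "f y \<le> f x + 2 / 2 ^ N" "f x \<le> f y + 2 / 2 ^ N"
        using z close by auto
      with N show "case z of (x, y) \<Rightarrow> \<bar>f x - f y\<bar> < \<epsilon>"
        by (simp add: xy abs_less_iff)
    qed
  qed
  ultimately show ?thesis
    using that[of f] f_ge f_le1 by blast
qed

section \<open>Small neighbourhoods of the unit space\<close>

text \<open>A locally finite family stays locally finite when its members are replaced by their closures,
  so it is enough to refine the open sets whose closure fits into a member of the given cover;
  regularity makes them a cover.\<close>

lemma paracompact_regular_closed_refinement:
  assumes "paracompact_space X" "regular_space X"
    and op: "\<And>U. U \<in> \<U> \<Longrightarrow> openin X U" and cover: "topspace X \<subseteq> \<Union>\<U>"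
  obtains \<C> where "\<And>C. C \<in> \<C> \<Longrightarrow> closedin X C" "topspace X \<subseteq> \<Union>\<C>"
    "\<And>C. C \<in> \<C> \<Longrightarrow> \<exists>U\<in>\<U>. C \<subseteq> U" "locally_finite_in X \<C>"
proof -
  define \<N> where "\<N> = {N. openin X N \<and> (\<exists>U\<in>\<U>. X closure_of N \<subseteq> U)}"
  have "\<exists>N\<in>\<N>. p \<in> N" if p: "p \<in> topspace X" for p
  proof -
    obtain U where U: "U \<in> \<U>" "p \<in> U"
      using cover p by blast
    then have "closedin X (topspace X - U)" "p \<in> topspace X - (topspace X - U)"
      using op[OF U(1)] U(2) p by auto
    then obtain N where N: "openin X N" "p \<in> N" "disjnt (topspace X - U) (X closure_of N)"
      using \<open>regular_space X\<close>[unfolded regular_space, THEN spec, THEN spec, THEN mp] by blast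
    then have "X closure_of N \<subseteq> U"
      using closure_of_subset_topspace[of X N] by (auto simp: disjnt_iff)
    with N U show ?thesis
      by (auto simp: \<N>_def)
  qed
  moreover have "\<forall>N\<in>\<N>. openin X N"
    by (simp add: \<N>_def)
  moreover have "\<Union>\<N> \<subseteq> topspace X"
    by (auto simp: \<N>_def dest: openin_subset)
  ultimately have \<N>: "(\<forall>N\<in>\<N>. openin X N) \<and> \<Union>\<N> = topspace X"
    by blast
  obtain \<V> where \<V>: "\<forall>V\<in>\<V>. openin X V" "\<Union>\<V> = topspace X"
    "\<forall>V\<in>\<V>. \<exists>N\<in>\<N>. V \<subseteq> N" "locally_finite_in X \<V>"
    using mp[OF spec[OF \<open>paracompact_space X\<close>[unfolded paracompact_space_def]] \<N>]
    by (elim exE conjE) (rule that)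
  show ?thesis
  proof (rule that[of "(\<lambda>V. X closure_of V) ` \<V>"])
    show "\<And>C. C \<in> (\<lambda>V. X closure_of V) ` \<V> \<Longrightarrow> closedin X C"
      by auto
    show "topspace X \<subseteq> \<Union> ((\<lambda>V. X closure_of V) ` \<V>)"
    proof
      fix p assume "p \<in> topspace X"
      then obtain V where "V \<in> \<V>" "p \<in> V"
        using \<V>(2) by blast
      then show "p \<in> \<Union> ((\<lambda>V. X closure_of V) ` \<V>)"
        using \<V>(1) closure_of_subset[of V X] openin_subset by blast
    qed
    show "locally_finite_in X ((\<lambda>V. X closure_of V) ` \<V>)"
      using \<V>(4) by (rule locally_finite_in_closure)
    show "\<exists>U\<in>\<U>. C \<subseteq> U" if C: "C \<in> (\<lambda>V. X closure_of V) ` \<V>" for C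
    proof -
      obtain V N U where "C = X closure_of V" "V \<subseteq> N" "X closure_of N \<subseteq> U" "U \<in> \<U>"
        using C \<V>(3) by (force simp: \<N>_def)
      then show ?thesis
        by (meson closure_of_mono subset_trans)
    qed
  qed
qed

context topological_groupoid
begin

lemma unit_product: "u \<in> topspace B \<Longrightarrow> gmult (\<iota> u) (\<iota> u) = \<iota> u"
  by (metis mult_unit_right source_unit unit_in)

lemma product_nhd:
  assumes "x \<in> topspace \<Omega>" "y \<in> topspace \<Omega>" "\<alpha> x = \<beta> y" "openin \<Omega> W" "gmult x y \<in> W"
  obtains U V where "openin \<Omega> U" "openin \<Omega> V" "x \<in> U" "y \<in> V"
    "\<And>a b. a \<in> U \<Longrightarrow> b \<in> V \<Longrightarrow> \<alpha> a = \<beta> b \<Longrightarrow> gmult a b \<in> W"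
proof -
  let ?X = "subtopology (prod_topology \<Omega> \<Omega>) (composable (topspace \<Omega>) \<alpha> \<beta>)"
  have "openin ?X {p \<in> topspace ?X. (\<lambda>(x, y). gmult x y) p \<in> W}"
    using continuous_mult \<open>openin \<Omega> W\<close> by (rule openin_continuous_map_preimage)
  then obtain T where T: "openin (prod_topology \<Omega> \<Omega>) T"
    "{p \<in> topspace ?X. (\<lambda>(x, y). gmult x y) p \<in> W} = T \<inter> composable (topspace \<Omega>) \<alpha> \<beta>"
    by (auto simp: openin_subtopology)
  have "(x, y) \<in> {p \<in> topspace ?X. (\<lambda>(x, y). gmult x y) p \<in> W}"
    using assms by (auto simp: composable_def)
  then have "(x, y) \<in> T"
    using T(2) by blast
  then obtain U V where UV: "openin \<Omega> U" "openin \<Omega> V" "x \<in> U" "y \<in> V" "U \<times> V \<subseteq> T"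
  proof -
    have "\<exists>U V. openin \<Omega> U \<and> openin \<Omega> V \<and> x \<in> U \<and> y \<in> V \<and> U \<times> V \<subseteq> T"
      using T(1) \<open>(x, y) \<in> T\<close> by (simp add: openin_prod_topology_alt)
    then show ?thesis
      using that by blast
  qed
  have "gmult a b \<in> W" if "a \<in> U" "b \<in> V" "\<alpha> a = \<beta> b" for a b
  proof -
    have "(a, b) \<in> T \<inter> composable (topspace \<Omega>) \<alpha> \<beta>"
      using that UV openin_subset[OF UV(1)] openin_subset[OF UV(2)] by (auto simp: composable_def)
    then have "(a, b) \<in> {p \<in> topspace ?X. (\<lambda>(x, y). gmult x y) p \<in> W}"
      using T(2) by simp
    then show ?thesis
      by simp
  qed
  then show ?thesis
    by (rule that[OF UV(1-4)])
qed

lemma continuous_unit_source: "continuous_map \<Omega> (subtopology \<Omega> (\<iota> ` topspace B)) (\<lambda>y. \<iota> (\<alpha> y))"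
  using continuous_map_compose[OF continuous_source continuous_unit] source_in
  by (auto simp: continuous_map_in_subtopology o_def)

lemma continuous_unit_target: "continuous_map \<Omega> (subtopology \<Omega> (\<iota> ` topspace B)) (\<lambda>y. \<iota> (\<beta> y))"
  using continuous_map_compose[OF continuous_target continuous_unit] target_in
  by (auto simp: continuous_map_in_subtopology o_def)

text \<open>Continuity of the product gives each unit a neighbourhood \<open>U\<close> with \<open>U \<cdot> U \<subseteq> W\<close>, but two
  composable arrows may lie in such neighbourhoods of different units. A closed locally finite cover
  \<open>\<C>\<close> of the unit space, each \<open>C\<close> inside one such \<open>U C\<close>, synchronises them: an arrow is admitted
  only if it lies in \<open>U C\<close> for every \<open>C\<close> that contains one of its two end points. Composable arrows
  \<open>x\<close>, \<open>y\<close> share the point \<open>\<alpha> x = \<beta> y\<close> and hence a common \<open>U C\<close>.\<close>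

lemma unit_nhd_square:
  assumes para: "paracompact_space (subtopology \<Omega> (\<iota> ` topspace B))"
    and reg: "regular_space (subtopology \<Omega> (\<iota> ` topspace B))"
    and W: "openin \<Omega> W" "\<iota> ` topspace B \<subseteq> W"
  obtains V where "openin \<Omega> V" "\<iota> ` topspace B \<subseteq> V"
    "\<And>x y. x \<in> V \<Longrightarrow> y \<in> V \<Longrightarrow> \<alpha> x = \<beta> y \<Longrightarrow> gmult x y \<in> W"
proof -
  let ?U = "\<iota> ` topspace B"
  let ?X = "subtopology \<Omega> ?U"
  have U_sub: "?U \<subseteq> topspace \<Omega>"
    using unit_in by blast
  then have top_X: "topspace ?X = ?U"
    by auto
  define good where "good U \<longleftrightarrow> openin \<Omega> U \<and>
    (\<forall>x\<in>U. \<forall>y\<in>U. \<alpha> x = \<beta> y \<longrightarrow> gmult x y \<in> W)" for U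
  have good_ex: "\<exists>U. good U \<and> \<iota> u \<in> U" if u: "u \<in> topspace B" for u
  proof -
    have "gmult (\<iota> u) (\<iota> u) \<in> W"
      using W(2) unit_product[OF u] u by auto
    then obtain U V where "openin \<Omega> U" "openin \<Omega> V" "\<iota> u \<in> U" "\<iota> u \<in> V"
      "\<And>a b. a \<in> U \<Longrightarrow> b \<in> V \<Longrightarrow> \<alpha> a = \<beta> b \<Longrightarrow> gmult a b \<in> W"
      using product_nhd[of "\<iota> u" "\<iota> u" W] W(1) u unit_in source_unit target_unit by metis
    then show ?thesis
      by (intro exI[of _ "U \<inter> V"]) (auto simp: good_def)
  qed
  define \<U> where "\<U> = {?U \<inter> U | U. good U}"
  have op: "openin ?X U" if "U \<in> \<U>" for U
    using that by (auto simp: \<U>_def good_def openin_subtopology_Int2)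
  have cover_\<U>: "topspace ?X \<subseteq> \<Union>\<U>"
  proof
    fix p assume "p \<in> topspace ?X"
    then obtain u where p: "u \<in> topspace B" "p = \<iota> u"
      using top_X by auto
    then obtain U where "good U" "p \<in> U"
      using good_ex by blast
    then have "?U \<inter> U \<in> \<U>" "p \<in> ?U \<inter> U"
      using p by (auto simp: \<U>_def)
    then show "p \<in> \<Union>\<U>"
      by (rule UnionI)
  qed
  obtain \<C> where clo: "\<And>C. C \<in> \<C> \<Longrightarrow> closedin ?X C" and cover: "topspace ?X \<subseteq> \<Union>\<C>"
    and ref: "\<And>C. C \<in> \<C> \<Longrightarrow> \<exists>U\<in>\<U>. C \<subseteq> U" and lf: "locally_finite_in ?X \<C>"
  proof -
    show ?thesis
      by (rule paracompact_regular_closed_refinement[OF para reg, of \<U>]; fact op cover_\<U> that)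
  qed
  have "\<forall>C\<in>\<C>. \<exists>U. good U \<and> C \<subseteq> U"
  proof
    fix C assume "C \<in> \<C>"
    then obtain U where "good U" "C \<subseteq> ?U \<inter> U"
      using ref[of C] by (auto simp: \<U>_def)
    then show "\<exists>U. good U \<and> C \<subseteq> U"
      by blast
  qed
  then obtain U where U: "\<And>C. C \<in> \<C> \<Longrightarrow> good (U C)" "\<And>C. C \<in> \<C> \<Longrightarrow> C \<subseteq> U C"
    by metis
  define V where "V = {y \<in> topspace \<Omega>. \<forall>C\<in>\<C>. \<iota> (\<alpha> y) \<in> C \<or> \<iota> (\<beta> y) \<in> C \<longrightarrow> y \<in> U C}"
  have nhd: "\<exists>Q. openin \<Omega> Q \<and> \<iota> u \<in> Q \<and> Q \<subseteq> V" if u: "u \<in> topspace B" for u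
  proof -
    obtain T where T: "openin ?X T" "\<iota> u \<in> T" and fin: "finite {C \<in> \<C>. C \<inter> T \<noteq> {}}"
    proof -
      have "\<iota> u \<in> topspace ?X"
        using u top_X by auto
      then show ?thesis
        using lf that unfolding locally_finite_in_def by meson
    qed
    \<comment> \<open>Only finitely many \<open>C\<close> meet \<open>T\<close>, and those that miss the unit at \<open>u\<close> are closed, so they can
      be cut away; an arrow with both ends in \<open>T'\<close> is then constrained only by those \<open>C\<close> that
      contain this unit.\<close>
    define T' where "T' = T - \<Union>{C \<in> \<C>. C \<inter> T \<noteq> {} \<and> \<iota> u \<notin> C}"
    have T': "openin ?X T'" "\<iota> u \<in> T'"
    proof -
      have "finite {C \<in> \<C>. C \<inter> T \<noteq> {} \<and> \<iota> u \<notin> C}"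
        using fin by (rule rev_finite_subset) auto
      then show "openin ?X T'"
        using T(1) clo unfolding T'_def by (intro openin_diff closedin_Union) auto
      show "\<iota> u \<in> T'"
        using T(2) by (simp add: T'_def)
    qed
    define Q where "Q = {y \<in> topspace \<Omega>. \<iota> (\<alpha> y) \<in> T'} \<inter> {y \<in> topspace \<Omega>. \<iota> (\<beta> y) \<in> T'}
      \<inter> \<Inter> (insert (topspace \<Omega>) (U ` {C \<in> \<C>. C \<inter> T \<noteq> {} \<and> \<iota> u \<in> C}))"
    have "openin \<Omega> Q"
      unfolding Q_def
    proof (intro openin_Int openin_Inter)
      show "openin \<Omega> {y \<in> topspace \<Omega>. \<iota> (\<alpha> y) \<in> T'}"
        using continuous_unit_source T'(1) by (rule openin_continuous_map_preimage)
      show "openin \<Omega> {y \<in> topspace \<Omega>. \<iota> (\<beta> y) \<in> T'}"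
        using continuous_unit_target T'(1) by (rule openin_continuous_map_preimage)
      show "finite (insert (topspace \<Omega>) (U ` {C \<in> \<C>. C \<inter> T \<noteq> {} \<and> \<iota> u \<in> C}))"
        using fin by (intro finite.insertI finite_imageI) (rule rev_finite_subset, auto)
      show "openin \<Omega> S"
        if "S \<in> insert (topspace \<Omega>) (U ` {C \<in> \<C>. C \<inter> T \<noteq> {} \<and> \<iota> u \<in> C})" for S
        using that U(1) by (auto simp: good_def)
    qed auto
    moreover have "\<iota> u \<in> Q"
      using T' U u unit_in source_unit target_unit by (auto simp: Q_def)
    moreover have "Q \<subseteq> V"
    proof
      fix y assume y: "y \<in> Q"
      have "y \<in> U C" if C: "C \<in> \<C>" "\<iota> (\<alpha> y) \<in> C \<or> \<iota> (\<beta> y) \<in> C" for C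
      proof -
        have "C \<inter> T' \<noteq> {}"
          using C y by (auto simp: Q_def)
        then have "C \<inter> T \<noteq> {}" "\<iota> u \<in> C"
          using C(1) by (auto simp: T'_def)
        with C(1) y show ?thesis
          by (auto simp: Q_def)
      qed
      with y show "y \<in> V"
        by (auto simp: V_def Q_def)
    qed
    ultimately show ?thesis
      by blast
  qed
  have square: "gmult x y \<in> W" if "x \<in> V" "y \<in> V" "\<alpha> x = \<beta> y" for x y
  proof -
    have "\<iota> (\<alpha> x) \<in> topspace ?X"
      using that(1) source_in top_X by (auto simp: V_def)
    then obtain C where C: "C \<in> \<C>" "\<iota> (\<alpha> x) \<in> C"
      using cover by blast
    then have "x \<in> U C" "y \<in> U C"
      using that by (auto simp: V_def)
    with U(1)[OF C(1)] that(3) show ?thesis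
      by (auto simp: good_def)
  qed
  show ?thesis
  proof (rule that[of "\<Omega> interior_of V"])
    show "openin \<Omega> (\<Omega> interior_of V)"
      by (rule openin_interior_of)
    show "\<iota> ` topspace B \<subseteq> \<Omega> interior_of V"
      using nhd unfolding interior_of_def by blast
    show "gmult x y \<in> W"
      if "x \<in> \<Omega> interior_of V" "y \<in> \<Omega> interior_of V" "\<alpha> x = \<beta> y" for x y
      using that interior_of_subset[of \<Omega> V] by (intro square) blast+
  qed
qed

text \<open>A neighbourhood of the unit space as a whole, not of a single unit: the filter is pushed
  forward along \<open>y \<mapsto> (\<alpha> y, \<beta> y)\<close> to a filter of entourages on the base.\<close>

definition unit_nhds :: "'a filter" where
  "unit_nhds = (INF V\<in>{V. openin \<Omega> V \<and> \<iota> ` topspace B \<subseteq> V}. principal V)"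

lemma eventually_unit_nhds:
  "eventually P unit_nhds \<longleftrightarrow> (\<exists>V. openin \<Omega> V \<and> \<iota> ` topspace B \<subseteq> V \<and> (\<forall>y\<in>V. P y))"
proof -
  let ?\<V> = "{V. openin \<Omega> V \<and> \<iota> ` topspace B \<subseteq> V}"
  have "topspace \<Omega> \<in> ?\<V>"
    using unit_in by auto
  moreover have "\<exists>V\<in>?\<V>. principal V \<le> inf (principal V1) (principal V2)"
    if "V1 \<in> ?\<V>" "V2 \<in> ?\<V>" for V1 V2
    using that by (intro bexI[of _ "V1 \<inter> V2"]) auto
  ultimately have "eventually P unit_nhds \<longleftrightarrow> (\<exists>V\<in>?\<V>. eventually P (principal V))"
    unfolding unit_nhds_def by (intro eventually_INF_base) auto
  then show ?thesis
    by (simp add: eventually_principal conj_assoc)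
qed

text \<open>Here the groupoid operations become the axioms of a uniformity: inversion gives symmetry and
  \<open>unit_nhd_square\<close> gives the square roots of entourages. The relation between \<open>w\<close> and \<open>u\<close> given by
  \<open>W\<close> is that some arrow of \<open>W\<close> leads from \<open>w\<close> to \<open>u\<close>.\<close>

lemma uniformly_continuous_base_bump:
  assumes para: "paracompact_space (subtopology \<Omega> (\<iota> ` topspace B))"
    and reg: "regular_space (subtopology \<Omega> (\<iota> ` topspace B))"
    and W: "openin \<Omega> W" "\<iota> ` topspace B \<subseteq> W" and w: "w \<in> topspace B"
  obtains f :: "'b \<Rightarrow> real" where "\<And>u. 0 \<le> f u" "\<And>u. f u \<le> 1" "f w = 0"
    "\<And>u. f u < 1 \<Longrightarrow> u \<in> \<beta> ` (W \<inter> source_fibre (topspace \<Omega>) \<alpha> w)"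
    "\<And>\<epsilon>. \<epsilon> > 0 \<Longrightarrow> eventually (\<lambda>y. \<bar>f (\<beta> y) - f (\<alpha> y)\<bar> < \<epsilon>) unit_nhds"
proof -
  let ?F = "filtermap (\<lambda>y. (\<alpha> y, \<beta> y)) unit_nhds"
  define E where "E = (\<lambda>(a, b). \<exists>y\<in>W. \<alpha> y = a \<and> \<beta> y = b)"
  have E: "eventually E ?F"
    using W by (auto simp: eventually_filtermap eventually_unit_nhds E_def)
  have Eww: "E (w, w)"
    using W w source_unit target_unit by (auto simp: E_def intro!: bexI[of _ "\<iota> w"])
  have sym: "eventually (\<lambda>(x, y). D (y, x)) ?F" if D: "eventually D ?F" for D
  proof -
    obtain V where V: "openin \<Omega> V" "\<iota> ` topspace B \<subseteq> V" "\<forall>y\<in>V. D (\<alpha> y, \<beta> y)"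
      using D by (auto simp: eventually_filtermap eventually_unit_nhds)
    let ?V = "{y \<in> topspace \<Omega>. ginv y \<in> V}"
    have "ginv (\<iota> u) = \<iota> u" if "u \<in> topspace B" for u
      by (metis inv_in inv_left mult_unit_right source_unit target_unit target_inv source_inv that unit_in)
    then have "\<iota> ` topspace B \<subseteq> ?V"
      using V(2) unit_in by auto
    moreover have "openin \<Omega> ?V"
      using continuous_inv V(1) by (rule openin_continuous_map_preimage)
    moreover have "D (\<beta> y, \<alpha> y)" if "y \<in> ?V" for y
      using that V(3) source_inv target_inv by force
    ultimately show ?thesis
      unfolding eventually_filtermap eventually_unit_nhds by (intro exI[of _ ?V]) auto
  qed
  have trans: "\<exists>D. eventually D ?F \<and> (\<forall>x y z. D (x, y) \<longrightarrow> D (y, z) \<longrightarrow> E (x, z))"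
    if E': "eventually E ?F" for E
  proof -
    obtain W where W: "openin \<Omega> W" "\<iota> ` topspace B \<subseteq> W" "\<forall>y\<in>W. E (\<alpha> y, \<beta> y)"
      using E' by (auto simp: eventually_filtermap eventually_unit_nhds)
    obtain V where V: "openin \<Omega> V" "\<iota> ` topspace B \<subseteq> V"
      "\<And>x y. x \<in> V \<Longrightarrow> y \<in> V \<Longrightarrow> \<alpha> x = \<beta> y \<Longrightarrow> gmult x y \<in> W"
      using unit_nhd_square[OF para reg W(1,2)] by metis
    define D where "D = (\<lambda>(a, b). \<exists>y\<in>V. \<alpha> y = a \<and> \<beta> y = b)"
    have "eventually D ?F"
      using V by (auto simp: eventually_filtermap eventually_unit_nhds D_def)
    moreover have "E (a, c)" if ab: "D (a, b)" and bc: "D (b, c)" for a b c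
    proof -
      obtain y z where yz: "y \<in> V" "\<alpha> y = a" "\<beta> y = b" "z \<in> V" "\<alpha> z = b" "\<beta> z = c"
        using ab bc by (auto simp: D_def)
      then have in\<Omega>: "y \<in> topspace \<Omega>" "z \<in> topspace \<Omega>"
        using openin_subset[OF V(1)] by auto
      \<comment> \<open>Arrows compose from right to left: \<open>y\<close> leads from \<open>a\<close> to \<open>b\<close> and \<open>z\<close> from \<open>b\<close> to \<open>c\<close>.\<close>
      have "gmult z y \<in> W"
        using V(3) yz by simp
      then have "E (\<alpha> (gmult z y), \<beta> (gmult z y))"
        using W(3) by blast
      then show ?thesis
        using in\<Omega> yz by (simp add: source_mult target_mult)
    qed
    ultimately show ?thesis
      by blast
  qed
  obtain f :: "'b \<Rightarrow> real" where f: "\<And>x. 0 \<le> f x" "\<And>x. f x \<le> 1" "f w = 0"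
    "\<And>x. f x < 1 \<Longrightarrow> E (w, x)"
    and uc: "\<And>\<epsilon>. \<epsilon> > 0 \<Longrightarrow> eventually (\<lambda>(x, y). \<bar>f x - f y\<bar> < \<epsilon>) ?F"
  proof -
    show ?thesis
      by (rule uniformly_continuous_bump[of ?F E w]; fact sym trans E Eww that)
  qed
  show ?thesis
  proof (rule that[of f])
    show "u \<in> \<beta> ` (W \<inter> source_fibre (topspace \<Omega>) \<alpha> w)" if "f u < 1" for u
      using f(4)[OF that] openin_subset[OF W(1)] by (auto simp: E_def source_fibre_def)
    show "eventually (\<lambda>y. \<bar>f (\<beta> y) - f (\<alpha> y)\<bar> < \<epsilon>) unit_nhds" if "\<epsilon> > 0" for \<epsilon>
      using uc[OF that] by (simp add: eventually_filtermap abs_minus_commute)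
  qed (use f in auto)
qed

end

section \<open>Openness of the target map on source fibres\<close>

context locally_compact_groupoid
begin

text \<open>The arrow \<open>k\<close> transports information to its target: near \<open>k\<close> the cut-off \<open>g\<close> suppresses the
  contribution of the source to the morphism \<open>F\<close>, so continuity of \<open>F\<close> at \<open>k\<close> controls \<open>f\<close> at the
  targets, and these fill a neighbourhood of \<open>\<beta> k\<close> because \<open>\<beta>\<close> is open.\<close>

lemma target_nhd_at_unit:
  assumes open_target: "open_map \<Omega> B \<beta>"
    and para: "paracompact_space (subtopology \<Omega> (\<iota> ` topspace B))"
    and auto_cont: "\<And>F :: 'a \<Rightarrow> real.
           \<lbrakk>real_morphism (topspace \<Omega>) \<alpha> \<beta> gmult F;
            \<And>u. u \<in> topspace B \<Longrightarrow> topcontinuous_at \<Omega> euclideanreal F (\<iota> u)\<rbrakk>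
           \<Longrightarrow> continuous_map \<Omega> euclideanreal F"
    and k: "k \<in> topspace \<Omega>" "\<alpha> k \<noteq> \<beta> k"
    and U: "openin \<Omega> U" "\<iota> (\<beta> k) \<in> U"
  obtains N where "openin B N" "\<beta> k \<in> N"
    "N \<subseteq> \<beta> ` (U \<inter> source_fibre (topspace \<Omega>) \<alpha> (\<beta> k))"
proof -
  define w where "w = \<beta> k"
  have w: "w \<in> topspace B" "\<alpha> k \<in> topspace B"
    using k target_in source_in by (auto simp: w_def)
  have creg: "completely_regular_space \<Omega>"
    using locally_compact_regular_imp_completely_regular_space locally_compact Hausdorff by blast
  have reg: "regular_space (subtopology \<Omega> (\<iota> ` topspace B))"
    using creg completely_regular_imp_regular_space regular_space_subtopology by blast
  have clo: "closedin \<Omega> {\<iota> u}" if "u \<in> topspace B" for u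
    using unit_in[OF that] by (rule closedin_Hausdorff_singleton[OF Hausdorff])
  \<comment> \<open>The part of \<open>W\<close> in the fibre over \<open>w\<close> lies in \<open>U\<close>, yet \<open>W\<close> contains every unit.\<close>
  define W where "W = U \<union> (topspace \<Omega> - {y \<in> topspace \<Omega>. \<iota> (\<alpha> y) \<in> {\<iota> w}})"
  have "continuous_map \<Omega> \<Omega> (\<lambda>y. \<iota> (\<alpha> y))"
    using continuous_map_compose[OF continuous_source continuous_unit] by (simp add: o_def)
  then have "closedin \<Omega> {y \<in> topspace \<Omega>. \<iota> (\<alpha> y) \<in> {\<iota> w}}"
    using clo[OF w(1)] by (rule closedin_continuous_map_preimage)
  then have W: "openin \<Omega> W" "\<iota> ` topspace B \<subseteq> W"
    using U w unit_in source_unit unfolding W_def w_def by (auto intro!: openin_Un)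
  obtain f :: "'b \<Rightarrow> real" where f: "\<And>u. 0 \<le> f u" "\<And>u. f u \<le> 1" "f w = 0"
    and f_less: "\<And>u. f u < 1 \<Longrightarrow> u \<in> \<beta> ` (W \<inter> source_fibre (topspace \<Omega>) \<alpha> w)"
    and f_uc: "\<And>\<epsilon>. \<epsilon> > 0 \<Longrightarrow> eventually (\<lambda>y. \<bar>f (\<beta> y) - f (\<alpha> y)\<bar> < \<epsilon>) unit_nhds"
  proof -
    show ?thesis
      by (rule uniformly_continuous_base_bump[OF para reg W w(1)]; fact that)
  qed
  have "\<iota> w \<in> topspace \<Omega> - {\<iota> (\<alpha> k)}"
    using w unit_in source_unit k(2) w_def by (metis Diff_iff singletonD)
  then obtain g0 where g0: "continuous_map \<Omega> (top_of_set {0..1::real}) g0"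
    "g0 (\<iota> w) = 0" "g0 ` {\<iota> (\<alpha> k)} \<subseteq> {1}"
    using creg[unfolded completely_regular_space_def, rule_format, OF conjI, OF clo[OF w(2)]]
    by blast
  define g where "g u = 1 - g0 (\<iota> u)" for u
  have g_w: "g w = 1" "g (\<alpha> k) = 0"
    using g0 by (auto simp: g_def)
  have g_bd: "0 \<le> g u" "g u \<le> 1" if "u \<in> topspace B" for u
    using g0(1) that unit_in by (auto simp: g_def continuous_map_in_subtopology Pi_iff)
  have "continuous_map \<Omega> euclideanreal g0"
    using g0(1) by (simp add: continuous_map_in_subtopology)
  then have "continuous_map B euclideanreal (\<lambda>u. g0 (\<iota> u))"
    using continuous_map_compose[OF continuous_unit] by (force simp: o_def)
  then have g_cont: "continuous_map B euclideanreal g"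
    unfolding g_def by (intro continuous_intros)
  then have g\<alpha>: "continuous_map \<Omega> euclideanreal (\<lambda>y. g (\<alpha> y))"
    and g\<beta>: "continuous_map \<Omega> euclideanreal (\<lambda>y. g (\<beta> y))"
    using continuous_map_compose[OF continuous_source, of euclideanreal g]
      continuous_map_compose[OF continuous_target, of euclideanreal g]
    by (simp_all add: o_def)
  define F where "F y = f (\<beta> y) * g (\<beta> y) - f (\<alpha> y) * g (\<alpha> y)" for y
  have "continuous_map \<Omega> euclideanreal F"
  proof (rule auto_cont)
    show "real_morphism (topspace \<Omega>) \<alpha> \<beta> gmult F"
      by (auto simp: real_morphism_def composable_def F_def source_mult target_mult)
    fix u assume u: "u \<in> topspace B"
    have F_u: "F (\<iota> u) = 0"
      using u by (simp add: F_def source_unit target_unit)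
    show "topcontinuous_at \<Omega> euclideanreal F (\<iota> u)"
      unfolding topcontinuous_at_def
    proof (intro conjI allI impI)
      fix T :: "real set" assume T: "openin euclideanreal T \<and> F (\<iota> u) \<in> T"
      then obtain \<epsilon> where \<epsilon>: "\<epsilon> > 0" "\<And>t. \<bar>t\<bar> < \<epsilon> \<Longrightarrow> t \<in> T"
        using F_u by (force simp: open_dist dist_real_def)
      obtain V where V: "openin \<Omega> V" "\<iota> ` topspace B \<subseteq> V"
        "\<forall>y\<in>V. \<bar>f (\<beta> y) - f (\<alpha> y)\<bar> < \<epsilon> / 2"
        using f_uc[of "\<epsilon> / 2"] \<epsilon>(1) by (auto simp: eventually_unit_nhds)
      define Q where "Q = {y \<in> topspace \<Omega>. g (\<beta> y) - g (\<alpha> y) \<in> {- (\<epsilon> / 2) <..< \<epsilon> / 2}}"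
      have "openin \<Omega> Q"
        unfolding Q_def
        by (rule openin_continuous_map_preimage[OF continuous_map_diff[OF g\<beta> g\<alpha>]]) simp
      moreover have "\<iota> u \<in> Q"
        using u unit_in \<epsilon>(1) by (auto simp: Q_def source_unit target_unit)
      moreover have "F y \<in> T" if y: "y \<in> V \<inter> Q" for y
      proof (rule \<epsilon>(2))
        have y': "y \<in> topspace \<Omega>"
          using y by (simp add: Q_def)
        \<comment> \<open>The first term is small by continuity of \<open>g\<close>, the second by uniform continuity of \<open>f\<close>;
          both factors in front are at most \<open>1\<close>.\<close>
        have "F y = f (\<beta> y) * (g (\<beta> y) - g (\<alpha> y)) + g (\<alpha> y) * (f (\<beta> y) - f (\<alpha> y))"
          by (simp add: F_def algebra_simps)
        also have "\<bar>\<dots>\<bar> \<le> f (\<beta> y) * \<bar>g (\<beta> y) - g (\<alpha> y)\<bar> + g (\<alpha> y) * \<bar>f (\<beta> y) - f (\<alpha> y)\<bar>"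
          using f g_bd y' source_in by (intro order_trans[OF abs_triangle_ineq]) (simp add: abs_mult)
        also have "\<dots> \<le> 1 * \<bar>g (\<beta> y) - g (\<alpha> y)\<bar> + 1 * \<bar>f (\<beta> y) - f (\<alpha> y)\<bar>"
          using f g_bd y' source_in by (intro add_mono mult_right_mono) auto
        also have "\<dots> < \<epsilon>"
        proof -
          have "\<bar>g (\<beta> y) - g (\<alpha> y)\<bar> < \<epsilon> / 2" "\<bar>f (\<beta> y) - f (\<alpha> y)\<bar> < \<epsilon> / 2"
            using V(3) y unfolding Q_def abs_less_iff by auto
          from add_strict_mono[OF this] show ?thesis
            by simp
        qed
        finally show "\<bar>F y\<bar> < \<epsilon>" .
      qed
      ultimately show "\<exists>Q. openin \<Omega> Q \<and> \<iota> u \<in> Q \<and> (\<forall>y\<in>Q. F y \<in> T)"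
        using V u by (intro exI[of _ "V \<inter> Q"]) auto
    qed (use u unit_in in auto)
  qed
  \<comment> \<open>If \<open>f (\<beta> y)\<close> were \<open>1\<close> for some \<open>y \<in> Q\<close>, then \<open>F y\<close> would exceed \<open>3/4 - 1/4\<close>.\<close>
  define Q where "Q = {y \<in> topspace \<Omega>. F y \<in> {..<1/4}} \<inter> {y \<in> topspace \<Omega>. g (\<beta> y) \<in> {3/4<..}}
    \<inter> {y \<in> topspace \<Omega>. g (\<alpha> y) \<in> {..<1/4}}"
  have Q: "openin \<Omega> Q"
    unfolding Q_def
    using \<open>continuous_map \<Omega> euclideanreal F\<close> g\<alpha> g\<beta>
    by (intro openin_Int openin_continuous_map_preimage[of _ euclideanreal]) auto
  have "k \<in> Q"
    using k f(3) g_w by (auto simp: Q_def F_def w_def)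
  have "f (\<beta> y) < 1" if y: "y \<in> Q" for y
  proof (rule ccontr)
    assume "\<not> f (\<beta> y) < 1"
    then have "f (\<beta> y) = 1"
      using f(2)[of "\<beta> y"] by linarith
    then have "F y = g (\<beta> y) - f (\<alpha> y) * g (\<alpha> y)"
      by (simp add: F_def)
    moreover have "f (\<alpha> y) * g (\<alpha> y) \<le> 1 * g (\<alpha> y)"
      using f g_bd source_in y by (intro mult_right_mono) (auto simp: Q_def)
    ultimately show False
      using y by (auto simp: Q_def)
  qed
  then have "\<beta> ` Q \<subseteq> \<beta> ` (W \<inter> source_fibre (topspace \<Omega>) \<alpha> w)"
    using f_less by blast
  also have "W \<inter> source_fibre (topspace \<Omega>) \<alpha> w = U \<inter> source_fibre (topspace \<Omega>) \<alpha> w"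
    by (auto simp: W_def source_fibre_def)
  finally show ?thesis
    using that[of "\<beta> ` Q"] Q \<open>k \<in> Q\<close> open_target by (auto simp: open_map_def w_def)
qed

end

theorem corollary8:
  fixes \<Omega> :: "'a topology" and B :: "'b topology"
    and \<alpha> \<beta> :: "'a \<Rightarrow> 'b" and \<iota> :: "'b \<Rightarrow> 'a"
    and gmult :: "'a \<Rightarrow> 'a \<Rightarrow> 'a" and ginv :: "'a \<Rightarrow> 'a"
  assumes "locally_compact_groupoid \<Omega> B \<alpha> \<beta> \<iota> gmult ginv"
    and "open_map \<Omega> B \<beta>"
    and "paracompact_space (subtopology \<Omega> (\<iota> ` topspace B))"
    and "\<And>F :: 'a \<Rightarrow> real.
           \<lbrakk>real_morphism (topspace \<Omega>) \<alpha> \<beta> gmult F;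
            \<And>u. u \<in> topspace B \<Longrightarrow> topcontinuous_at \<Omega> euclideanreal F (\<iota> u)\<rbrakk>
           \<Longrightarrow> continuous_map \<Omega> euclideanreal F"
    and "v \<in> topspace B"
    and "groupoid_orbit (topspace \<Omega>) (topspace B) \<alpha> \<beta> v \<noteq> {v}"
  shows "open_map (subtopology \<Omega> (source_fibre (topspace \<Omega>) \<alpha> v)) B \<beta>"
proof -
  interpret locally_compact_groupoid \<Omega> B \<alpha> \<beta> \<iota> gmult ginv
    by fact
  let ?\<Omega>\<^sub>v = "source_fibre (topspace \<Omega>) \<alpha> v"
  have "v \<in> groupoid_orbit (topspace \<Omega>) (topspace B) \<alpha> \<beta> v"
    using \<open>v \<in> topspace B\<close> unit_in source_unit target_unit
    by (force simp: groupoid_orbit_def target_fibre_def source_fibre_def)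
  then obtain u where "u \<noteq> v" "u \<in> groupoid_orbit (topspace \<Omega>) (topspace B) \<alpha> \<beta> v"
    using assms(6) by blast
  then obtain y where y: "y \<in> topspace \<Omega>" "\<alpha> y = v" "\<beta> y \<noteq> v"
    by (auto simp: groupoid_orbit_def target_fibre_def source_fibre_def)
  have nhd: "\<exists>N. openin B N \<and> \<beta> x \<in> N \<and> N \<subseteq> \<beta> ` (S \<inter> ?\<Omega>\<^sub>v)"
    if S: "openin \<Omega> S" and x: "x \<in> S" "x \<in> ?\<Omega>\<^sub>v" for S x
  proof -
    have x': "x \<in> topspace \<Omega>" "\<alpha> x = v"
      using x by (auto simp: source_fibre_def)
    \<comment> \<open>An arrow with target \<open>\<beta> x\<close> and a different source: \<open>x\<close> itself, unless \<open>x\<close> is a loop at \<open>v\<close>.\<close>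
    have "\<exists>k\<in>topspace \<Omega>. \<beta> k = \<beta> x \<and> \<alpha> k \<noteq> \<beta> k"
    proof (cases "\<beta> x = v")
      case True
      then show ?thesis
        using y by (intro bexI[of _ "ginv y"]) (auto simp: inv_in source_inv target_inv)
    qed (use x' in auto)
    then obtain k where k: "k \<in> topspace \<Omega>" "\<beta> k = \<beta> x" "\<alpha> k \<noteq> \<beta> k"
      by blast
    \<comment> \<open>Right translation by \<open>x\<close> maps a neighbourhood \<open>U\<close> of the unit at \<open>\<beta> x\<close>, within the fibre over
      \<open>\<beta> x\<close>, into \<open>S\<close> and preserves targets.\<close>
    have "gmult (\<iota> (\<beta> x)) x \<in> S"
      using x x' by (simp add: mult_unit_left)
    then obtain U V where U: "openin \<Omega> U" "\<iota> (\<beta> x) \<in> U" "x \<in> V"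
      and UV: "\<And>a b. a \<in> U \<Longrightarrow> b \<in> V \<Longrightarrow> \<alpha> a = \<beta> b \<Longrightarrow> gmult a b \<in> S"
      using product_nhd[of "\<iota> (\<beta> x)" x S] S x' unit_in target_in source_unit by metis
    obtain N where N: "openin B N" "\<beta> x \<in> N"
      "N \<subseteq> \<beta> ` (U \<inter> source_fibre (topspace \<Omega>) \<alpha> (\<beta> x))"
      using target_nhd_at_unit[OF assms(2,3,4) k(1,3) U(1)] U(2) k(2) by metis
    have "\<beta> a \<in> \<beta> ` (S \<inter> ?\<Omega>\<^sub>v)" if a: "a \<in> U" "a \<in> source_fibre (topspace \<Omega>) \<alpha> (\<beta> x)" for a
    proof (rule image_eqI)
      have a': "a \<in> topspace \<Omega>" "\<alpha> a = \<beta> x"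
        using a by (auto simp: source_fibre_def)
      then show "\<beta> a = \<beta> (gmult a x)"
        using x' by (simp add: target_mult)
      show "gmult a x \<in> S \<inter> ?\<Omega>\<^sub>v"
        using a a' x' UV U(3) by (simp add: source_fibre_def source_mult mult_in)
    qed
    with N show ?thesis
      by blast
  qed
  show ?thesis
    unfolding open_map_def
  proof (intro allI impI)
    fix T assume "openin (subtopology \<Omega> ?\<Omega>\<^sub>v) T"
    then obtain S where S: "openin \<Omega> S" "T = S \<inter> ?\<Omega>\<^sub>v"
      by (auto simp: openin_subtopology)
    show "openin B (\<beta> ` T)"
      by (subst openin_subopen) (use nhd[OF S(1)] S(2) in blast)
  qed
qed

end
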